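(* Let $m\ge 2$, let $\mathcal{P}$ be an order-$m$, $n$-dimensional stochastic tensor representing an $(m-1)$th-order Markov chain, let $0\le\alpha<1$, and let $v\in\mathbb{R}^n$ be a stochastic vector. Then the higher-order PageRank stationary distribution tensor $\mathcal{X}$ of $(\alpha,\mathcal{P},v)$ exists and is unique. Moreover, for every stochastic starting vector $y_0\in\mathbb{R}^{n^{m-1}}$, the iteration $y_{t+1}=M y_t$, where $M=\alpha P+(1-\alpha)V$, satisfies, for every integer $k\ge 0$, $$\|y_{(m-1)k}-\operatorname{vec}(\mathcal{X})\|_1\le 2\bigl(1-(1-\alpha)^{m-1}\bigr)^k .$$
   Context: A vector is stochastic if its entries are nonnegative and sum to $1$. An order-$m$, $n$-dimensional tensor is an array with $m$ indices, each ranging over $1,\dots,n$; it is stochastic if its entries are nonnegative and, for every fixed choice of the remaining indices, the sum over the first index equals $1$. The entry $\mathcal{P}(i,j,\dots,\ell,k)$ is the probability of moving to state $i$ when the last $m-1$ states, from most recent to oldest, were $j,\dots,\ell,k$. The higher-order PageRank (stationary distribution) tensor of $(\alpha,\mathcal{P},v)$ is the order-$(m-1)$, $n$-dimensional tensor $\mathcal{X}$ with nonnegative entries summing to $1$ that satisfies $$\mathcal{X}(i,j,\dots,\ell)=\alpha\sum_k \mathcal{P}(i,j,\dots,\ell,k)\,\mathcal{X}(j,\dots,\ell,k)+(1-\alpha)v_i\sum_k\mathcal{X}(j,\dots,\ell,k).$$ $\operatorname{vec}$ stacks the entries of an order-$(m-1)$ tensor into a vector of length $n^{m-1}$ with the first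 index varying fastest, so that position $(i_1,\dots,i_{m-1})$ corresponds to $e_{i_{m-1}}\otimes\cdots\otimes e_{i_1}$ ($e_i$ the standard basis vectors of $\mathbb{R}^n$, $\otimes$ the Kronecker product). The reduced form $P$ of $\mathcal{P}$ is the $n^{m-1}\times n^{m-1}$ matrix, indexed in this ordering, whose entry in row $(i,j,\dots,\ell)$ and column $(j,\dots,\ell,k)$ is $\mathcal{P}(i,j,\dots,\ell,k)$ and whose other entries are $0$. The matrix $V$ is $V=e^T\otimes I\otimes\cdots\otimes I\otimes v$ with $m-2$ factors $I$, where $e\in\mathbb{R}^n$ is the all-ones vector and $I$ the $n\times n$ identity. The equation for $\mathcal{X}$ is equivalent to $\operatorname{vec}(\mathcal{X})=M\operatorname{vec}(\mathcal{X})$. *)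

theory Defs
  imports "Jordan_Normal_Form.Matrix" "HOL-Library.FuncSet"
begin

definition stochastic_vec :: "nat \<Rightarrow> real vec \<Rightarrow> bool" where
  "stochastic_vec N x \<longleftrightarrow>
     x \<in> carrier_vec N \<and> (\<forall>i<N. 0 \<le> x $ i) \<and> (\<Sum>i<N. x $ i) = 1"

definition l1_norm :: "real vec \<Rightarrow> real" where
  "l1_norm x = (\<Sum>i<dim_vec x. \<bar>x $ i\<bar>)"

text \<open>Indices are 0-based. A tensor of order \<open>r\<close> and dimension \<open>n\<close> is a function on the lists of
  length \<open>r\<close> over \<open>{..<n}\<close>; it takes the fixed value \<open>undefined\<close> on all other lists, so that equality
  of functions is equality of arrays.\<close>

definition indices :: "nat \<Rightarrow> nat \<Rightarrow> nat list set" where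
  "indices r n = {is. length is = r \<and> set is \<subseteq> {..<n}}"

definition tensors :: "nat \<Rightarrow> nat \<Rightarrow> (nat list \<Rightarrow> real) set" where
  "tensors r n = indices r n \<rightarrow>\<^sub>E UNIV"

definition stochastic_tensor :: "nat \<Rightarrow> nat \<Rightarrow> (nat list \<Rightarrow> real) \<Rightarrow> bool" where
  "stochastic_tensor m n P \<longleftrightarrow>
     P \<in> tensors m n \<and>
     (\<forall>is\<in>indices m n. 0 \<le> P is) \<and>
     (\<forall>js\<in>indices (m - 1) n. (\<Sum>i<n. P (i # js)) = 1)"

text \<open>In the defining equation, \<open>js\<close> stands for the index block \<open>j, \<dots>, \<ell>\<close>, which is empty if
  \<open>m = 2\<close>.\<close>

definition pagerank_tensor ::
  "nat \<Rightarrow> nat \<Rightarrow> real \<Rightarrow> (nat list \<Rightarrow> real) \<Rightarrow> real vec \<Rightarrow> (nat list \<Rightarrow> real) \<Rightarrow> bool" where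
  "pagerank_tensor m n \<alpha> P v X \<longleftrightarrow>
     X \<in> tensors (m - 1) n \<and>
     (\<forall>is\<in>indices (m - 1) n. 0 \<le> X is) \<and>
     (\<Sum>is\<in>indices (m - 1) n. X is) = 1 \<and>
     (\<forall>i<n. \<forall>js\<in>indices (m - 2) n.
        X (i # js) = \<alpha> * (\<Sum>k<n. P (i # js @ [k]) * X (js @ [k]))
                     + (1 - \<alpha>) * v $ i * (\<Sum>k<n. X (js @ [k])))"

text \<open>The index list of length \<open>r\<close> at position \<open>p\<close> when the first index varies fastest, i.e.\ the
  base-\<open>n\<close> digits of \<open>p\<close>, least significant first.\<close>

definition index_at :: "nat \<Rightarrow> nat \<Rightarrow> nat \<Rightarrow> nat list" where
  "index_at r n p = map (\<lambda>s. p div n ^ s mod n) [0..<r]"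

lemma index_at_Cons:
  assumes "i < n"
  shows "index_at (Suc r) n (i + n * p) = i # index_at r n p"
proof -
  have "(i + n * p) div n ^ Suc s = p div n ^ s" for s
    using assms by (simp add: div_mult2_eq)
  then show ?thesis
    using assms unfolding index_at_def upt_conv_Cons[OF zero_less_Suc] map_Suc_upt[symmetric]
    by (simp add: o_def)
qed

lemma index_at_horner_sum:
  assumes "is \<in> indices r n"
  shows "index_at r n (horner_sum id n is) = is"
  using assms
proof (induction "is" arbitrary: r)
  case Nil
  then show ?case by (simp add: indices_def index_at_def)
next
  case (Cons i "is")
  then obtain r' where "r = Suc r'" "is \<in> indices r' n" "i < n"
    by (auto simp: indices_def)
  then show ?case
    using Cons.IH[of r'] by (simp add: index_at_Cons)
qed

definition tensor_vec :: "nat \<Rightarrow> nat \<Rightarrow> (nat list \<Rightarrow> real) \<Rightarrow> real vec" where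
  "tensor_vec r n X = vec (n ^ r) (\<lambda>p. X (index_at r n p))"

text \<open>A row \<open>(i, j, \<dots>, \<ell>)\<close> and a column \<open>(j, \<dots>, \<ell>, k)\<close> are exactly a row \<open>a\<close> and a column \<open>b\<close>
  with \<open>tl a = butlast b\<close>.\<close>

definition reduced_form :: "nat \<Rightarrow> nat \<Rightarrow> (nat list \<Rightarrow> real) \<Rightarrow> real mat" where
  "reduced_form m n P =
     mat (n ^ (m - 1)) (n ^ (m - 1)) (\<lambda>(p, q).
       let a = index_at (m - 1) n p; b = index_at (m - 1) n q
       in if tl a = butlast b then P (a @ [last b]) else 0)"

definition kronecker :: "real mat \<Rightarrow> real mat \<Rightarrow> real mat" (infixr \<open>\<otimes>\<^sub>K\<close> 70) where
  "A \<otimes>\<^sub>K B =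
     mat (dim_row A * dim_row B) (dim_col A * dim_col B) (\<lambda>(i, j).
       A $$ (i div dim_row B, j div dim_col B) * B $$ (i mod dim_row B, j mod dim_col B))"

text \<open>\<open>e\<^sup>T \<otimes> I \<otimes> \<dots> \<otimes> I \<otimes> v\<close> with \<open>m - 2\<close> factors \<open>I\<close>, bracketed to the right; for \<open>m = 2\<close>
  this is \<open>e\<^sup>T \<otimes> v\<close>.\<close>

definition teleport_mat :: "nat \<Rightarrow> nat \<Rightarrow> real vec \<Rightarrow> real mat" where
  "teleport_mat m n v =
     mat_of_rows n [vec n (\<lambda>_. 1)] \<otimes>\<^sub>K
       (((\<lambda>A. 1\<^sub>m n \<otimes>\<^sub>K A) ^^ (m - 2)) (mat_of_cols n [v]))"

definition pagerank_mat :: "nat \<Rightarrow> nat \<Rightarrow> real \<Rightarrow> (nat list \<Rightarrow> real) \<Rightarrow> real vec \<Rightarrow> real mat" where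
  "pagerank_mat m n \<alpha> P v =
     \<alpha> \<cdot>\<^sub>m reduced_form m n P + (1 - \<alpha>) \<cdot>\<^sub>m teleport_mat m n v"

end

theory Submission
  imports Defs
begin

text \<open>The equation for the PageRank tensor is the stationarity condition of a first-order Markov chain
  whose states are the windows \<open>(i, j, \<dots>, \<ell>)\<close> of the \<open>r = m - 1\<close> most recent states: from the window
  \<open>(j, \<dots>, \<ell>, k)\<close> the chain moves to \<open>(i, j, \<dots>, \<ell>)\<close> with probability
  \<open>\<alpha> * P(i, j, \<dots>, \<ell>, k) + (1 - \<alpha>) * v i\<close>. With probability \<open>1 - \<alpha>\<close> a step thus draws the new
  state from \<open>v\<close>, whatever the window was. When this happens \<open>r\<close> times in a row, the window consists of
  \<open>r\<close> independent draws from \<open>v\<close> and the initial window is forgotten. So \<open>r\<close> steps send a nonnegative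
  function of total mass \<open>s\<close> to one that is at least \<open>(1 - \<alpha>) ^ r * s\<close> times the product distribution
  \<open>v i\<^sub>1 * \<dots> * v i\<^sub>r\<close> (lemma \<open>steps_ge\<close>).

  This is Doeblin's minorization condition. It makes \<open>r\<close> steps a contraction in the \<open>\<ell>\<^sub>1\<close> norm, with
  factor \<open>1 - (1 - \<alpha>) ^ r\<close>, on the functions of total mass zero (lemma \<open>contraction\<close>). Differences of
  distributions are such functions, and their \<open>\<ell>\<^sub>1\<close> norm is at most 2; existence, uniqueness and the
  rate all follow from this. Finally, the matrix \<open>\<alpha> P + (1 - \<alpha>) V\<close> is the transition matrix of this
  chain when windows are numbered by their base-\<open>n\<close> value (lemma \<open>pagerank_mat_entry\<close>), so the vector
  iteration is the evolution of a distribution on windows.\<close>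

section \<open>Stochastic kernels with a minorization\<close>

locale stochastic_kernel =
  fixes A :: "'a set" and K :: "'a \<Rightarrow> 'a \<Rightarrow> real"
  assumes finite_states: "finite A"
    and kernel_nonneg: "\<lbrakk>x \<in> A; y \<in> A\<rbrakk> \<Longrightarrow> 0 \<le> K x y"
    and kernel_sum: "y \<in> A \<Longrightarrow> (\<Sum>x\<in>A. K x y) = 1"
begin

definition step :: "('a \<Rightarrow> real) \<Rightarrow> 'a \<Rightarrow> real" where
  "step f = (\<lambda>x. \<Sum>y\<in>A. K x y * f y)"

definition distribution :: "('a \<Rightarrow> real) \<Rightarrow> bool" where
  "distribution f \<longleftrightarrow> (\<forall>x\<in>A. 0 \<le> f x) \<and> sum f A = 1"

definition stationary :: "('a \<Rightarrow> real) \<Rightarrow> bool" where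
  "stationary f \<longleftrightarrow> (\<forall>x\<in>A. step f x = f x)"

lemma step_cong: "(\<And>x. x \<in> A \<Longrightarrow> f x = g x) \<Longrightarrow> step f = step g"
  unfolding step_def by simp

lemma sum_step: "sum (step f) A = sum f A"
proof -
  have "sum (step f) A = (\<Sum>y\<in>A. \<Sum>x\<in>A. K x y * f y)"
    unfolding step_def by (rule sum.swap)
  also have "\<dots> = sum f A"
    by (simp add: sum_distrib_right[symmetric] kernel_sum)
  finally show ?thesis .
qed

lemma step_nonneg: "(\<And>x. x \<in> A \<Longrightarrow> 0 \<le> f x) \<Longrightarrow> x \<in> A \<Longrightarrow> 0 \<le> step f x"
  unfolding step_def by (intro sum_nonneg mult_nonneg_nonneg kernel_nonneg)

lemma step_diff: "step (\<lambda>x. f x - g x) = (\<lambda>x. step f x - step g x)"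
  unfolding step_def by (simp add: right_diff_distrib sum_subtractf)

lemma sum_steps: "sum ((step ^^ t) f) A = sum f A"
  by (induction t) (simp_all add: sum_step)

lemma steps_nonneg:
  "(\<And>x. x \<in> A \<Longrightarrow> 0 \<le> f x) \<Longrightarrow> x \<in> A \<Longrightarrow> 0 \<le> (step ^^ t) f x"
  by (induction t arbitrary: x) (simp_all add: step_nonneg)

lemma steps_diff: "(step ^^ t) (\<lambda>x. f x - g x) = (\<lambda>x. (step ^^ t) f x - (step ^^ t) g x)"
  by (induction t) (simp_all add: step_diff)

lemma steps_stationary: "stationary f \<Longrightarrow> x \<in> A \<Longrightarrow> (step ^^ t) f x = f x"
proof (induction t arbitrary: x)
  case (Suc t)
  then have "step ((step ^^ t) f) = step f"
    by (intro step_cong) auto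
  with Suc.prems show ?case
    by (simp add: stationary_def)
qed simp

lemma sum_abs_diff_distributions:
  assumes "distribution f" "distribution g"
  shows "(\<Sum>x\<in>A. \<bar>f x - g x\<bar>) \<le> 2"
proof -
  have "(\<Sum>x\<in>A. \<bar>f x - g x\<bar>) \<le> (\<Sum>x\<in>A. f x + g x)"
    using assms by (intro sum_mono) (fastforce simp: distribution_def)
  also have "\<dots> = 2"
    using assms by (simp add: sum.distrib distribution_def)
  finally show ?thesis .
qed

end

text \<open>Doeblin's condition: after \<open>r\<close> steps, a fraction \<open>\<epsilon>\<close> of any mass has been redistributed
  according to \<open>w\<close>, whatever the starting state was.\<close>

locale doeblin_kernel = stochastic_kernel +
  fixes r :: nat and \<epsilon> :: real and w :: "'a \<Rightarrow> real"
  assumes eps_pos: "0 < \<epsilon>" and eps_le: "\<epsilon> \<le> 1"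
    and distribution_w: "distribution w"
    and minorization:
      "\<lbrakk>\<And>x. x \<in> A \<Longrightarrow> 0 \<le> f x; x \<in> A\<rbrakk> \<Longrightarrow> \<epsilon> * sum f A * w x \<le> (step ^^ r) f x"
begin

text \<open>The positive and the negative part of \<open>f\<close> have the same mass, so the portions of them that
  the minorization sends to \<open>w\<close> cancel; only the fraction \<open>1 - \<epsilon>\<close> of each part survives.\<close>

lemma contraction:
  assumes "sum f A = 0"
  shows "(\<Sum>x\<in>A. \<bar>(step ^^ r) f x\<bar>) \<le> (1 - \<epsilon>) * (\<Sum>x\<in>A. \<bar>f x\<bar>)"
proof -
  define p where "p x = max (f x) 0" for x
  define q where "q x = max (- f x) 0" for x
  have f: "f = (\<lambda>x. p x - q x)" and abs_f: "\<bar>f x\<bar> = p x + q x" for x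
    unfolding p_def q_def by auto
  have mass: "sum p A = sum q A"
    using assms by (simp add: f sum_subtractf)
  define c where "c x = \<epsilon> * sum q A * w x" for x
  have sum_c: "sum c A = \<epsilon> * sum q A"
    using distribution_w
    by (simp add: c_def[abs_def] sum_distrib_left[symmetric] distribution_def)
  have "\<bar>(step ^^ r) f x\<bar> \<le> (step ^^ r) p x + (step ^^ r) q x - 2 * c x" if "x \<in> A" for x
  proof -
    have "c x \<le> (step ^^ r) p x" "c x \<le> (step ^^ r) q x"
      using minorization[of p x] minorization[of q x] that mass
      by (simp_all add: c_def p_def q_def)
    then show ?thesis
      by (simp add: f steps_diff)
  qed
  then have "(\<Sum>x\<in>A. \<bar>(step ^^ r) f x\<bar>)
      \<le> (\<Sum>x\<in>A. (step ^^ r) p x + (step ^^ r) q x - 2 * c x)"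
    by (rule sum_mono)
  also have "\<dots> = sum p A + sum q A - 2 * (\<epsilon> * sum q A)"
    by (simp add: sum_subtractf sum.distrib sum_steps sum_distrib_left[symmetric] sum_c)
  also have "\<dots> = (1 - \<epsilon>) * (\<Sum>x\<in>A. \<bar>f x\<bar>)"
    by (simp add: abs_f sum.distrib mass algebra_simps)
  finally show ?thesis .
qed

lemma contraction_power:
  assumes "sum f A = 0"
  shows "(\<Sum>x\<in>A. \<bar>(step ^^ (r * k)) f x\<bar>) \<le> (1 - \<epsilon>) ^ k * (\<Sum>x\<in>A. \<bar>f x\<bar>)"
proof (induction k)
  case (Suc k)
  have "(\<Sum>x\<in>A. \<bar>(step ^^ (r * Suc k)) f x\<bar>)
      = (\<Sum>x\<in>A. \<bar>(step ^^ r) ((step ^^ (r * k)) f) x\<bar>)"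
    by (simp add: funpow_add)
  also have "\<dots> \<le> (1 - \<epsilon>) * (\<Sum>x\<in>A. \<bar>(step ^^ (r * k)) f x\<bar>)"
    using assms by (intro contraction) (simp add: sum_steps)
  also have "\<dots> \<le> (1 - \<epsilon>) * ((1 - \<epsilon>) ^ k * (\<Sum>x\<in>A. \<bar>f x\<bar>))"
    using Suc eps_le by (intro mult_left_mono) auto
  finally show ?case
    by simp
qed simp

lemma convergence_rate:
  assumes "distribution f" "distribution g"
  shows "(\<Sum>x\<in>A. \<bar>(step ^^ (r * k)) f x - (step ^^ (r * k)) g x\<bar>) \<le> 2 * (1 - \<epsilon>) ^ k"
proof -
  have "(\<Sum>x\<in>A. \<bar>(step ^^ (r * k)) f x - (step ^^ (r * k)) g x\<bar>)
      \<le> (1 - \<epsilon>) ^ k * (\<Sum>x\<in>A. \<bar>f x - g x\<bar>)"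
    using contraction_power[of "\<lambda>x. f x - g x" k] assms
    by (simp add: steps_diff distribution_def sum_subtractf)
  also have "\<dots> \<le> (1 - \<epsilon>) ^ k * 2"
    using eps_le sum_abs_diff_distributions[OF assms] by (intro mult_left_mono) auto
  finally show ?thesis
    by (simp add: mult.commute)
qed

lemma rate_tendsto_zero: "(\<lambda>k. 2 * (1 - \<epsilon>) ^ k) \<longlonglongrightarrow> 0"
  using eps_pos eps_le by (intro tendsto_mult_right_zero LIMSEQ_power_zero) auto

lemma steps_diff_tendsto_zero:
  assumes "distribution f" "distribution g" "x \<in> A"
  shows "(\<lambda>k. (step ^^ (r * k)) f x - (step ^^ (r * k)) g x) \<longlonglongrightarrow> 0"
proof (rule tendsto_rabs_zero_cancel, rule tendsto_sandwich[OF _ _ tendsto_const rate_tendsto_zero])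
  have "\<bar>(step ^^ (r * k)) f x - (step ^^ (r * k)) g x\<bar>
      \<le> (\<Sum>x\<in>A. \<bar>(step ^^ (r * k)) f x - (step ^^ (r * k)) g x\<bar>)" for k
    using assms(3) finite_states by (intro member_le_sum) auto
  then show "\<forall>\<^sub>F k in sequentially. \<bar>(step ^^ (r * k)) f x - (step ^^ (r * k)) g x\<bar>
      \<le> 2 * (1 - \<epsilon>) ^ k"
    using convergence_rate[OF assms(1,2)] by (intro always_eventually allI) (rule order_trans)
qed simp

lemma stationary_unique:
  assumes "distribution f" "stationary f" "distribution g" "stationary g" "x \<in> A"
  shows "f x = g x"
proof -
  have "(\<lambda>k. f x - g x) \<longlonglongrightarrow> 0"
    using steps_diff_tendsto_zero[OF assms(1,3,5)] assms by (simp add: steps_stationary)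
  then show ?thesis
    by (simp add: LIMSEQ_const_iff)
qed

text \<open>The stationary distribution is the limit of \<open>step ^^ (r * k)\<close> applied to \<open>w\<close>. Successive
  members of this sequence are the images of the distributions \<open>(step ^^ r) w\<close> and \<open>w\<close> under the same
  power of \<open>step\<close>, hence their differences are summable; the limit is stationary because the sequences that start in
  \<open>step w\<close> and in \<open>w\<close> have the same limit.\<close>

lemma stationary_exists: "\<exists>f. distribution f \<and> stationary f"
proof -
  define z where "z k = (step ^^ (r * k)) w" for k
  have dist_steps: "distribution ((step ^^ t) w)" for t
    using distribution_w by (auto simp: distribution_def sum_steps steps_nonneg)
  have "convergent (\<lambda>k. z k x)" if "x \<in> A" for x
  proof -
    have "summable (\<lambda>k. z (Suc k) x - z k x)"
    proof (rule summable_comparison_test')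
      show "summable (\<lambda>k. 2 * (1 - \<epsilon>) ^ k)"
        using eps_pos eps_le by (intro summable_mult summable_geometric) auto
      fix k :: nat
      have "norm (z (Suc k) x - z k x) = \<bar>(step ^^ (r * k)) ((step ^^ r) w) x - (step ^^ (r * k)) w x\<bar>"
        by (simp add: z_def funpow_add[symmetric, THEN fun_cong, unfolded o_def] add.commute)
      also have "\<dots> \<le> (\<Sum>x\<in>A. \<bar>(step ^^ (r * k)) ((step ^^ r) w) x - (step ^^ (r * k)) w x\<bar>)"
        using that finite_states by (intro member_le_sum) auto
      also have "\<dots> \<le> 2 * (1 - \<epsilon>) ^ k"
        by (rule convergence_rate[OF dist_steps distribution_w])
      finally show "norm (z (Suc k) x - z k x) \<le> 2 * (1 - \<epsilon>) ^ k" .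
    qed
    then have "convergent (\<lambda>k. \<Sum>j<k. z (Suc j) x - z j x)"
      by (simp add: summable_iff_convergent)
    then have "convergent (\<lambda>k. z k x - z 0 x)"
      by (simp only: sum_lessThan_telescope[of "\<lambda>k. z k x"])
    then show ?thesis
      by (simp add: convergent_diff_const_right_iff)
  qed
  then obtain f where lim: "\<And>x. x \<in> A \<Longrightarrow> (\<lambda>k. z k x) \<longlonglongrightarrow> f x"
    unfolding convergent_def by metis
  have "distribution f"
    unfolding distribution_def
  proof (intro conjI ballI)
    show "0 \<le> f x" if "x \<in> A" for x
      using dist_steps that
      by (intro LIMSEQ_le_const[OF lim[OF that]]) (auto simp: z_def distribution_def)
    have "(\<lambda>k. sum (z k) A) \<longlonglongrightarrow> sum f A"
      by (intro tendsto_sum lim)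
    then show "sum f A = 1"
      using dist_steps by (simp add: z_def distribution_def LIMSEQ_const_iff)
  qed
  moreover have "step f x = f x" if "x \<in> A" for x
  proof -
    have "(\<lambda>k. step (z k) x) \<longlonglongrightarrow> step f x"
      unfolding step_def by (intro tendsto_sum tendsto_mult tendsto_const lim)
    then have "(\<lambda>k. step (z k) x - z k x) \<longlonglongrightarrow> step f x - f x"
      by (intro tendsto_diff lim that)
    moreover have "(\<lambda>k. step (z k) x - z k x) \<longlonglongrightarrow> 0"
      using steps_diff_tendsto_zero[OF dist_steps[of 1] distribution_w that]
      by (simp add: z_def funpow_swap1)
    ultimately show ?thesis
      using LIMSEQ_unique by fastforce
  qed
  ultimately show ?thesis
    unfolding stationary_def by blast
qed

end

section \<open>Index lists and their positions\<close>

lemma finite_indices [simp]: "finite (indices r n)"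
  unfolding indices_def using finite_lists_length_eq[of "{..<n}" r] by (simp add: conj_commute)

lemma card_indices: "card (indices r n) = n ^ r"
  unfolding indices_def using card_lists_length_eq[of "{..<n}" r] by (simp add: conj_commute)

lemma indices_0 [simp]: "indices 0 n = {[]}"
  by (auto simp: indices_def)

lemma indices_append:
  "is \<in> indices r n \<Longrightarrow> js \<in> indices s n \<Longrightarrow> is @ js \<in> indices (r + s) n"
  by (auto simp: indices_def)

lemma Cons_in_indices [simp]: "i # is \<in> indices (Suc r) n \<longleftrightarrow> i < n \<and> is \<in> indices r n"
  by (auto simp: indices_def)

lemma snoc_in_indices [simp]: "is @ [i] \<in> indices (Suc r) n \<longleftrightarrow> i < n \<and> is \<in> indices r n"
  by (auto simp: indices_def)

lemma indices_SucE:
  assumes "is \<in> indices (Suc r) n"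
  obtains i js where "is = i # js" "i < n" "js \<in> indices r n"
  using assms by (cases "is") (auto simp: indices_def)

lemma indices_Suc_snocE:
  assumes "is \<in> indices (Suc r) n"
  obtains js i where "is = js @ [i]" "i < n" "js \<in> indices r n"
  using assms by (cases "is" rule: rev_cases) (auto simp: indices_def)

lemma ball_indices_Suc:
  "(\<forall>is\<in>indices (Suc r) n. Q is) \<longleftrightarrow> (\<forall>i<n. \<forall>js\<in>indices r n. Q (i # js))"
  by (auto elim: indices_SucE)

lemma sum_indices_Suc:
  "(\<Sum>is\<in>indices (Suc r) n. f is) = (\<Sum>i<n. \<Sum>js\<in>indices r n. f (i # js))"
  unfolding sum.cartesian_product
  by (rule sum.reindex_bij_witness[of _ "\<lambda>(i, js). i # js" "\<lambda>is. (hd is, tl is)"])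
    (auto elim: indices_SucE)

lemma sum_indices_Suc_snoc:
  "(\<Sum>is\<in>indices (Suc r) n. f is) = (\<Sum>js\<in>indices r n. \<Sum>i<n. f (js @ [i]))"
  unfolding sum.cartesian_product
  by (rule sum.reindex_bij_witness[of _ "\<lambda>(js, i). js @ [i]" "\<lambda>is. (butlast is, last is)"])
    (auto elim: indices_Suc_snocE)

text \<open>The Horner sum numbers the index lists by \<open>{..<n ^ r}\<close>, inverting the decoding of positions into
  digits.\<close>

lemma horner_sum_less: "is \<in> indices r n \<Longrightarrow> horner_sum id n is < n ^ r"
proof (induction "is" arbitrary: r)
  case (Cons i "is")
  then obtain r' where r: "r = Suc r'" "is \<in> indices r' n" "i < n"
    by (auto simp: indices_def)
  have "Suc (horner_sum id n is) \<le> n ^ r'"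
    using Cons.IH[OF r(2)] by (rule Suc_leI)
  then have "n * Suc (horner_sum id n is) \<le> n * n ^ r'"
    by (rule mult_le_mono2)
  then show ?case
    using r by (simp add: id_def)
qed (simp add: indices_def)

lemma index_at_in_indices: "0 < n \<Longrightarrow> index_at r n p \<in> indices r n"
  by (auto simp: index_at_def indices_def)

lemma bij_betw_index_at:
  assumes "0 < n"
  shows "bij_betw (index_at r n) {..<n ^ r} (indices r n)"
proof -
  have "index_at r n ` {..<n ^ r} = indices r n"
  proof
    show "index_at r n ` {..<n ^ r} \<subseteq> indices r n"
      using assms by (auto simp: index_at_in_indices)
    show "indices r n \<subseteq> index_at r n ` {..<n ^ r}"
    proof
      fix "is" assume "is \<in> indices r n"
      then show "is \<in> index_at r n ` {..<n ^ r}"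
        using index_at_horner_sum[of "is" r n] horner_sum_less[of "is" r n]
        by (intro image_eqI[of _ _ "horner_sum id n is"]) auto
    qed
  qed
  then show ?thesis
    by (simp add: bij_betw_def eq_card_imp_inj_on card_indices)
qed

text \<open>In position form, dropping the most recent state divides by \<open>n\<close>, and dropping the oldest state
  removes the most significant digit.\<close>

lemma tl_index_at: "tl (index_at (Suc r) n p) = index_at r n (p div n)"
  by (simp add: index_at_def upt_conv_Cons map_Suc_upt[symmetric] o_def div_mult2_eq del: upt_Suc)

lemma hd_index_at: "hd (index_at (Suc r) n p) = p mod n"
  by (simp add: index_at_def upt_conv_Cons del: upt_Suc)

lemma butlast_index_at: "butlast (index_at (Suc r) n p) = index_at r n (p mod n ^ r)"
proof -
  have "p div n ^ s mod n = p mod n ^ r div n ^ s mod n" if "s < r" for s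
  proof (cases "n = 0")
    case True
    then have "n ^ r = 0"
      using that by simp
    then show ?thesis
      by (simp only: mod_by_0)
  next
    case False
    have "n ^ r = n ^ s * n ^ (r - s)" "n dvd n ^ (r - s)"
      using that by (simp_all add: power_add[symmetric] dvd_power)
    with False show ?thesis
      by (simp add: mod_mult2_eq mod_mod_cancel)
  qed
  then show ?thesis
    by (simp add: index_at_def)
qed

lemma sum_index_at:
  "0 < n \<Longrightarrow> (\<Sum>p<n ^ r. f (index_at r n p)) = (\<Sum>is\<in>indices r n. f is)"
  by (rule sum.reindex_bij_betw[OF bij_betw_index_at])

lemma l1_norm_tensor_vec_diff:
  "0 < n \<Longrightarrow> l1_norm (tensor_vec r n f - tensor_vec r n g) = (\<Sum>is\<in>indices r n. \<bar>f is - g is\<bar>)"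
  using sum_index_at[of n "\<lambda>is. \<bar>f is - g is\<bar>" r] by (simp add: l1_norm_def tensor_vec_def)

lemma tensor_vec_horner_sum:
  assumes "0 < n" "y \<in> carrier_vec (n ^ r)"
  shows "tensor_vec r n (\<lambda>is. y $ horner_sum id n is) = y"
proof (rule eq_vecI)
  fix p assume "p < dim_vec y"
  with assms have p: "p < n ^ r"
    by simp
  let ?p = "horner_sum id n (index_at r n p)"
  have "index_at r n ?p = index_at r n p" "?p < n ^ r"
    using assms by (simp_all add: index_at_horner_sum horner_sum_less index_at_in_indices)
  with p have "?p = p"
    using bij_betw_imp_inj_on[OF bij_betw_index_at[OF assms(1)]] by (auto dest: inj_onD)
  with p show "tensor_vec r n (\<lambda>is. y $ horner_sum id n is) $ p = y $ p"
    by (simp add: tensor_vec_def)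
qed (use assms in \<open>simp add: tensor_vec_def\<close>)

section \<open>The teleportation matrix\<close>

text \<open>The inner factors form \<open>I\<close> of size \<open>n ^ d\<close>, tensored with the column \<open>v\<close>: row \<open>p\<close> carries the
  entry of \<open>v\<close> at its lowest digit, in the column given by the remaining digits.\<close>

lemma identity_kronecker_column:
  assumes "v \<in> carrier_vec n" "0 < n"
  shows "((\<lambda>A. 1\<^sub>m n \<otimes>\<^sub>K A) ^^ d) (mat_of_cols n [v])
    = mat (n ^ Suc d) (n ^ d) (\<lambda>(p, q). if p div n = q then v $ (p mod n) else 0)"
proof (induction d)
  case 0
  show ?case
    using assms by (intro eq_matI) (auto simp: mat_of_cols_def)
next
  case (Suc d)
  \<comment> \<open>Two numbers agree iff they agree in the top digit and in the lower \<open>d\<close> digits; the two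
    conjuncts come from the new identity factor and from the induction hypothesis.\<close>
  have digits: "p div n ^ Suc d = q div n ^ d \<and> p mod n ^ Suc d div n = q mod n ^ d
      \<longleftrightarrow> p div n = q" for p q
  proof -
    have "p div n ^ Suc d = p div n div n ^ d" "p mod n ^ Suc d div n = p div n mod n ^ d"
      using assms(2) by (simp_all add: div_mult2_eq mod_mult2_eq)
    then show ?thesis
      by (metis div_mult_mod_eq)
  qed
  have mod_n: "p mod n ^ Suc d mod n = p mod n" for p
    by (simp add: mod_mod_cancel)
  show ?case
    unfolding funpow.simps o_apply Suc
  proof (rule eq_matI)
    fix p q
    assume "p < dim_row (mat (n ^ Suc (Suc d)) (n ^ Suc d)
        (\<lambda>(p, q). if p div n = q then v $ (p mod n) else 0))"
      and "q < dim_col (mat (n ^ Suc (Suc d)) (n ^ Suc d)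
        (\<lambda>(p, q). if p div n = q then v $ (p mod n) else 0))"
    then have "p < n * n ^ Suc d" "q < n * n ^ d"
      by simp_all
    moreover from this have "p div n ^ Suc d < n" "q div n ^ d < n"
      by (simp_all only: less_mult_imp_div_less)
    moreover have "p mod n ^ Suc d < n ^ Suc d" "q mod n ^ d < n ^ d"
      using assms(2) by simp_all
    ultimately show "(1\<^sub>m n \<otimes>\<^sub>K mat (n ^ Suc d) (n ^ d)
          (\<lambda>(p, q). if p div n = q then v $ (p mod n) else 0)) $$ (p, q)
        = mat (n ^ Suc (Suc d)) (n ^ Suc d)
          (\<lambda>(p, q). if p div n = q then v $ (p mod n) else 0) $$ (p, q)"
      using digits[of p q] mod_n[of p] by (auto simp: kronecker_def simp del: power_Suc simp flip: power_Suc)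
  qed (simp_all add: kronecker_def)
qed

text \<open>The factor \<open>e\<^sup>T\<close> has a single row, so it ignores the top digit of the column index, i.e. the
  oldest state.\<close>

lemma teleport_mat_eq:
  assumes "v \<in> carrier_vec n" "0 < n"
  shows "teleport_mat (Suc (Suc d)) n v = mat (n ^ Suc d) (n ^ Suc d)
    (\<lambda>(p, q). if p div n = q mod n ^ d then v $ (p mod n) else 0)"
proof -
  have "q div n ^ d < n" "q mod n ^ d < n ^ d" if "q < n * n ^ d" for q
    using that assms(2) by (simp_all add: less_mult_imp_div_less)
  then show ?thesis
    unfolding teleport_mat_def
    by (intro eq_matI)
      (auto simp: identity_kronecker_column[OF assms] kronecker_def mat_of_rows_def)
qed

section \<open>The chain on index lists\<close>

text \<open>The order of the tensor is written \<open>d + 2\<close>: a window has \<open>d + 1\<close> states, and consecutive windows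
  overlap in \<open>d\<close> of them.\<close>

locale higher_order_pagerank =
  fixes d n :: nat and P :: "nat list \<Rightarrow> real" and \<alpha> :: real and v :: "real vec"
  assumes stochastic_P: "stochastic_tensor (Suc (Suc d)) n P"
    and alpha_nonneg: "0 \<le> \<alpha>" and alpha_less: "\<alpha> < 1"
    and stochastic_v: "stochastic_vec n v"
begin

text \<open>The first entry of \<open>is\<close> is the new state and the others are the window that is left.\<close>

definition transition :: "nat list \<Rightarrow> real" where
  "transition is = \<alpha> * P is + (1 - \<alpha>) * v $ hd is"

definition kernel :: "nat list \<Rightarrow> nat list \<Rightarrow> real" where
  "kernel a b = (if tl a = butlast b then transition (a @ [last b]) else 0)"

lemma n_pos: "0 < n"
  using stochastic_v by (cases n) (auto simp: stochastic_vec_def)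

lemma v_nonneg: "i < n \<Longrightarrow> 0 \<le> v $ i"
  using stochastic_v by (simp add: stochastic_vec_def)

lemma v_sum: "(\<Sum>i<n. v $ i) = 1"
  using stochastic_v by (simp add: stochastic_vec_def)

lemma transition_ge:
  "is \<in> indices (Suc (Suc d)) n \<Longrightarrow> (1 - \<alpha>) * v $ hd is \<le> transition is"
  using stochastic_P alpha_nonneg by (simp add: transition_def stochastic_tensor_def)

lemma transition_sum:
  assumes "js \<in> indices (Suc d) n"
  shows "(\<Sum>i<n. transition (i # js)) = 1"
proof -
  have "(\<Sum>i<n. P (i # js)) = 1"
    using stochastic_P assms by (simp add: stochastic_tensor_def)
  then show ?thesis
    by (simp add: transition_def sum.distrib sum_distrib_left[symmetric] v_sum)
qed

sublocale stochastic_kernel "indices (Suc d) n" kernel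
proof
  show "0 \<le> kernel a b" if ab: "a \<in> indices (Suc d) n" "b \<in> indices (Suc d) n" for a b
  proof -
    obtain i js where i: "a = i # js" "i < n" "js \<in> indices d n"
      using ab(1) by (rule indices_SucE)
    obtain ks k where k: "b = ks @ [k]" "k < n"
      using ab(2) by (rule indices_Suc_snocE)
    have "0 \<le> (1 - \<alpha>) * v $ i"
      using alpha_less v_nonneg i by simp
    also have "\<dots> \<le> transition (a @ [k])"
      using transition_ge[of "i # js @ [k]"] i k by simp
    finally show ?thesis
      by (simp add: kernel_def k)
  qed
  show "(\<Sum>a\<in>indices (Suc d) n. kernel a b) = 1" if b: "b \<in> indices (Suc d) n" for b
  proof -
    obtain ks k where k: "b = ks @ [k]" "k < n" "ks \<in> indices d n"
      using b by (rule indices_Suc_snocE)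
    have "(\<Sum>a\<in>indices (Suc d) n. kernel a b) = (\<Sum>i<n. transition (i # b))"
      using k by (simp add: sum_indices_Suc kernel_def)
    then show ?thesis
      using transition_sum[OF b] by simp
  qed
qed simp

lemma step_Cons:
  assumes "js \<in> indices d n"
  shows "step f (i # js) = (\<Sum>k<n. transition (i # js @ [k]) * f (js @ [k]))"
proof -
  have "step f (i # js)
      = (\<Sum>ks\<in>indices d n. if js = ks then (\<Sum>k<n. transition (i # js @ [k]) * f (js @ [k])) else 0)"
    unfolding step_def sum_indices_Suc_snoc by (intro sum.cong) (auto simp: kernel_def)
  with assms show ?thesis
    by simp
qed

text \<open>Each step teleports with probability \<open>1 - \<alpha>\<close>, and the newest state is then drawn from \<open>v\<close>
  independently of the history.\<close>

lemma step_ge: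
  assumes f: "\<And>a. a \<in> indices (Suc d) n \<Longrightarrow> 0 \<le> f a" and "i < n" "js \<in> indices d n"
  shows "(1 - \<alpha>) * v $ i * (\<Sum>k<n. f (js @ [k])) \<le> step f (i # js)"
  unfolding step_Cons[OF assms(3)] sum_distrib_left
  using assms transition_ge[of "i # js @ [_]"] by (intro sum_mono mult_right_mono) auto

text \<open>With probability \<open>(1 - \<alpha>) ^ s\<close> the \<open>s\<close> most recent states are all teleported; the \<open>s\<close> oldest
  states have then left the window and are summed out. Keeping the surviving block \<open>js\<close> general is what
  makes the induction on \<open>s\<close> work; for the full window \<open>js\<close> is empty and the sum is the total mass.\<close>

lemma steps_ge:
  assumes f: "\<And>a. a \<in> indices (Suc d) n \<Longrightarrow> 0 \<le> f a"
    and "is \<in> indices s n" "js \<in> indices (Suc d - s) n" "s \<le> Suc d"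
  shows "(1 - \<alpha>) ^ s * prod_list (map (($) v) is) * (\<Sum>ks\<in>indices s n. f (js @ ks))
    \<le> (step ^^ s) f (is @ js)"
  using assms(2-4)
proof (induction s arbitrary: "is" js)
  case 0
  then show ?case by simp
next
  case (Suc s)
  obtain i as where i: "is = i # as" "i < n" "as \<in> indices s n"
    using Suc.prems(1) by (rule indices_SucE)
  have js: "js \<in> indices (d - s) n" and s: "s \<le> d"
    using Suc.prems by auto
  have "(1 - \<alpha>) ^ Suc s * prod_list (map (($) v) is) * (\<Sum>ks\<in>indices (Suc s) n. f (js @ ks))
      = (1 - \<alpha>) * v $ i * (\<Sum>k<n. (1 - \<alpha>) ^ s * prod_list (map (($) v) as)
          * (\<Sum>ks\<in>indices s n. f ((js @ [k]) @ ks)))"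
    by (simp add: i sum_indices_Suc sum_distrib_left[symmetric])
  also have "\<dots> \<le> (1 - \<alpha>) * v $ i * (\<Sum>k<n. (step ^^ s) f (as @ js @ [k]))"
  proof (intro mult_left_mono sum_mono)
    fix k assume "k \<in> {..<n}"
    then show "(1 - \<alpha>) ^ s * prod_list (map (($) v) as) * (\<Sum>ks\<in>indices s n. f ((js @ [k]) @ ks))
        \<le> (step ^^ s) f (as @ js @ [k])"
      using i js s by (intro Suc.IH) (auto simp: Suc_diff_le)
  qed (use alpha_less v_nonneg i in auto)
  also have "\<dots> \<le> step ((step ^^ s) f) (i # as @ js)"
  proof -
    have "as @ js \<in> indices d n"
      using indices_append[OF i(3) js] s by simp
    then show ?thesis
      using step_ge[of "(step ^^ s) f" i "as @ js"] steps_nonneg f i by simp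
  qed
  finally show ?case
    by (simp add: i)
qed

lemma sum_prod_list_v: "(\<Sum>is\<in>indices s n. prod_list (map (($) v) is)) = 1"
  by (induction s) (simp_all add: sum_indices_Suc sum_distrib_left[symmetric] v_sum)

sublocale doeblin_kernel "indices (Suc d) n" kernel "Suc d" "(1 - \<alpha>) ^ Suc d"
  "\<lambda>is. prod_list (map (($) v) is)"
proof
  show "0 < (1 - \<alpha>) ^ Suc d" "(1 - \<alpha>) ^ Suc d \<le> 1"
    using alpha_nonneg alpha_less by (auto intro: power_le_one simp del: power_Suc)
  show "distribution (\<lambda>is. prod_list (map (($) v) is))"
    unfolding distribution_def sum_prod_list_v
    by (auto simp: indices_def v_nonneg subset_iff intro!: prod_list_nonneg)
  show "(1 - \<alpha>) ^ Suc d * sum f (indices (Suc d) n) * prod_list (map (($) v) a)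
      \<le> (step ^^ Suc d) f a"
    if "\<And>x. x \<in> indices (Suc d) n \<Longrightarrow> 0 \<le> f x" "a \<in> indices (Suc d) n" for f a
    using steps_ge[of f a "Suc d" "[]"] that by (simp add: mult_ac)
qed

lemma pagerank_tensor_iff:
  "pagerank_tensor (Suc (Suc d)) n \<alpha> P v X \<longleftrightarrow>
     X \<in> tensors (Suc d) n \<and> distribution X \<and> stationary X"
proof -
  have "step X (i # js) = \<alpha> * (\<Sum>k<n. P (i # js @ [k]) * X (js @ [k]))
      + (1 - \<alpha>) * v $ i * (\<Sum>k<n. X (js @ [k]))" if "js \<in> indices d n" for i js
    by (simp add: step_Cons[OF that] transition_def sum_distrib_left sum.distrib[symmetric]
        algebra_simps)
  then have "stationary X \<longleftrightarrow> (\<forall>i<n. \<forall>js\<in>indices d n.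
      X (i # js) = \<alpha> * (\<Sum>k<n. P (i # js @ [k]) * X (js @ [k]))
        + (1 - \<alpha>) * v $ i * (\<Sum>k<n. X (js @ [k])))"
    unfolding stationary_def ball_indices_Suc by (metis (no_types, lifting))
  then show ?thesis
    by (auto simp: pagerank_tensor_def distribution_def)
qed

text \<open>A stationary function is determined on the windows only; extending it by \<open>undefined\<close> elsewhere
  turns it into the tensor and makes uniqueness an equality of functions.\<close>

lemma pagerank_tensor_ex1: "\<exists>!X. pagerank_tensor (Suc (Suc d)) n \<alpha> P v X"
proof -
  obtain f where f: "distribution f" "stationary f"
    using stationary_exists by blast
  define X where "X = restrict f (indices (Suc d) n)"
  have "step X = step f"
    by (rule step_cong) (simp add: X_def)
  with f have "pagerank_tensor (Suc (Suc d)) n \<alpha> P v X"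
    by (simp add: pagerank_tensor_iff distribution_def stationary_def tensors_def X_def)
  moreover have "X = Y" if "pagerank_tensor (Suc (Suc d)) n \<alpha> P v X"
    "pagerank_tensor (Suc (Suc d)) n \<alpha> P v Y" for X Y
    using that unfolding pagerank_tensor_iff tensors_def
    by (auto intro: PiE_ext stationary_unique)
  ultimately show ?thesis
    by blast
qed

text \<open>Both \<open>P\<close> and \<open>V\<close> are supported on the pairs of overlapping windows: in \<open>V\<close> the overlap
  \<open>tl a = butlast b\<close> appears as \<open>p div n = q mod n ^ d\<close>, which says the same because digit expansions
  of length \<open>d\<close> are unique.\<close>

lemma pagerank_mat_entry:
  assumes "p < n ^ Suc d" "q < n ^ Suc d"
  shows "pagerank_mat (Suc (Suc d)) n \<alpha> P v $$ (p, q)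
    = kernel (index_at (Suc d) n p) (index_at (Suc d) n q)"
proof -
  have v: "v \<in> carrier_vec n"
    using stochastic_v by (simp add: stochastic_vec_def)
  have "p div n < n ^ d" "q mod n ^ d < n ^ d"
    using assms n_pos by (simp_all add: less_mult_imp_div_less mult.commute)
  then have "tl (index_at (Suc d) n p) = butlast (index_at (Suc d) n q)
      \<longleftrightarrow> p div n = q mod n ^ d"
    unfolding tl_index_at butlast_index_at
    using bij_betw_imp_inj_on[OF bij_betw_index_at[OF n_pos]] by (auto dest: inj_onD)
  moreover have "hd (index_at (Suc d) n p @ [k]) = p mod n" for k
    using hd_index_at[of d n p] by (subst hd_append) (auto simp: index_at_def)
  ultimately show ?thesis
    using assms
    by (auto simp: pagerank_mat_def teleport_mat_eq[OF v n_pos] reduced_form_def kernel_def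
        transition_def Let_def simp del: power_Suc)
qed

lemma pagerank_mat_mult_tensor_vec:
  "pagerank_mat (Suc (Suc d)) n \<alpha> P v *\<^sub>v tensor_vec (Suc d) n f = tensor_vec (Suc d) n (step f)"
proof -
  have dims: "dim_row (pagerank_mat (Suc (Suc d)) n \<alpha> P v) = n ^ Suc d"
    "dim_col (pagerank_mat (Suc (Suc d)) n \<alpha> P v) = n ^ Suc d"
    using stochastic_v n_pos
    by (simp_all add: pagerank_mat_def reduced_form_def teleport_mat_eq stochastic_vec_def)
  show ?thesis
  proof (rule eq_vecI)
    fix p assume "p < dim_vec (tensor_vec (Suc d) n (step f))"
    then have p: "p < n ^ Suc d"
      by (simp add: tensor_vec_def)
    have "(pagerank_mat (Suc (Suc d)) n \<alpha> P v *\<^sub>v tensor_vec (Suc d) n f) $ p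
        = (\<Sum>q<n ^ Suc d. kernel (index_at (Suc d) n p) (index_at (Suc d) n q)
            * f (index_at (Suc d) n q))"
      using p dims
      by (simp add: scalar_prod_def tensor_vec_def pagerank_mat_entry lessThan_atLeast0
          del: power_Suc)
    also have "\<dots> = step f (index_at (Suc d) n p)"
      unfolding step_def by (rule sum_index_at[OF n_pos])
    finally show "(pagerank_mat (Suc (Suc d)) n \<alpha> P v *\<^sub>v tensor_vec (Suc d) n f) $ p
        = tensor_vec (Suc d) n (step f) $ p"
      using p by (simp add: tensor_vec_def)
  qed (use dims in \<open>simp add: tensor_vec_def\<close>)
qed

lemma pagerank_iteration_rate:
  assumes X: "pagerank_tensor (Suc (Suc d)) n \<alpha> P v X"
    and y0: "stochastic_vec (n ^ Suc d) (y 0)"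
    and y: "\<And>t. y (Suc t) = pagerank_mat (Suc (Suc d)) n \<alpha> P v *\<^sub>v y t"
  shows "l1_norm (y (Suc d * k) - tensor_vec (Suc d) n X) \<le> 2 * (1 - (1 - \<alpha>) ^ Suc d) ^ k"
proof -
  define f where "f = (\<lambda>is. y 0 $ horner_sum id n is)"
  have f: "tensor_vec (Suc d) n f = y 0"
    unfolding f_def using y0 n_pos by (intro tensor_vec_horner_sum) (simp_all add: stochastic_vec_def)
  have "distribution f"
    unfolding distribution_def
  proof (intro conjI ballI)
    show "0 \<le> f a" if "a \<in> indices (Suc d) n" for a
      using y0 horner_sum_less[OF that] by (simp add: f_def stochastic_vec_def)
    have "sum f (indices (Suc d) n) = (\<Sum>p<n ^ Suc d. tensor_vec (Suc d) n f $ p)"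
      unfolding sum_index_at[OF n_pos, symmetric] by (simp add: tensor_vec_def)
    then show "sum f (indices (Suc d) n) = 1"
      using y0 by (simp add: f stochastic_vec_def)
  qed
  have iterates: "y t = tensor_vec (Suc d) n ((step ^^ t) f)" for t
    by (induction t) (simp_all add: f y pagerank_mat_mult_tensor_vec)
  have X': "distribution X" "stationary X"
    using X by (simp_all add: pagerank_tensor_iff)
  have "l1_norm (y (Suc d * k) - tensor_vec (Suc d) n X)
      = (\<Sum>a\<in>indices (Suc d) n. \<bar>(step ^^ (Suc d * k)) f a - (step ^^ (Suc d * k)) X a\<bar>)"
    unfolding iterates l1_norm_tensor_vec_diff[OF n_pos]
    by (intro sum.cong refl) (simp only: steps_stationary[OF X'(2)])
  also have "\<dots> \<le> 2 * (1 - (1 - \<alpha>) ^ Suc d) ^ k"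
    by (rule convergence_rate[OF \<open>distribution f\<close> X'(1)])
  finally show ?thesis .
qed

end

theorem corollary3p5:
  fixes m n :: nat and P :: "nat list \<Rightarrow> real" and \<alpha> :: real and v :: "real vec"
  assumes "m \<ge> 2"
    and "stochastic_tensor m n P"
    and "0 \<le> \<alpha>" and "\<alpha> < 1"
    and "stochastic_vec n v"
  shows "(\<exists>!X. pagerank_tensor m n \<alpha> P v X) \<and>
    (\<forall>X y. pagerank_tensor m n \<alpha> P v X \<longrightarrow>
       stochastic_vec (n ^ (m - 1)) (y 0) \<longrightarrow>
       (\<forall>t. y (Suc t) = pagerank_mat m n \<alpha> P v *\<^sub>v y t) \<longrightarrow>
       (\<forall>k. l1_norm (y ((m - 1) * k) - tensor_vec (m - 1) n X)
              \<le> 2 * (1 - (1 - \<alpha>) ^ (m - 1)) ^ k))"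
proof -
  define d where "d = m - 2"
  have m: "m = Suc (Suc d)" "m - 1 = Suc d"
    using assms(1) by (simp_all add: d_def)
  interpret higher_order_pagerank d n P \<alpha> v
    using assms m by unfold_locales simp_all
  show ?thesis
    unfolding m(2) unfolding m(1)
    using pagerank_tensor_ex1 pagerank_iteration_rate by blast
qed

end
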